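(* Let $q\ge1$, $n\ge1$, and consider a transitive element $(S,X_i,\pi_i)$ of $(q+2)\text{-OA}(n)$ (a transitive set of $q$ MOLS of order $n$). Let $(G,H_i)_{i=1}^{q+2}$ be a group packet in $(q+2)\text{-GP}(n)$ with $G$ finite, whose associated orthogonal array $G/K\subset\prod_iG/H_i$ is isotopic to $(S,X_i,\pi_i)$. Let $p$ be a prime and $a\ge0$ with $p^a\mid n$ and $p^{a+1}\nmid n$. If a Sylow $p$-subgroup $P$ of $G$ is normal in $G$ (i.e. unique), then $q\le p^a-1$.
   Context: An element of $(q+2)\text{-OA}(n)$ is $(S,X_i,\pi_i)_{i=1}^{q+2}$ with $|X_i|=n$ and $\pi_i\colon S\to X_i$ such that $\pi_i\times\pi_j\colon S\to X_i\times X_j$ is bijective for all $i\ne j$. An isotopy is a collection of bijections $\sigma\colon S\to S'$, $\sigma_i\colon X_i\to X'_i$ with $\pi'_i\sigma=\sigma_i\pi_i$. Regarding $S\subset\prod_iX_i$, the autotopy group is $\{(\sigma_i)\in\prod_i\mathrm{Sym}(X_i):(\sigma_i)(S)=S\}$ and the array is transitive if this group acts transitively on $S$. A group packet in $(q+2)\text{-GP}(n)$ is $(G,H_i)_{i=1}^{q+2}$ with $G$ a group, $H_i\le G$, such that there is a subgroup $K$ with $H_i\cap H_j=K$ for all $i\ne j$ and $[G:H_i]=[H_i:K]=n$. Its associated orthogonal array is $S=G/K$, $X_i=G/H_i$, $\pi_i(gK)=gH_i$.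
   Formalization: The formal statement assumes a ≥ 1 (p divides n) instead of a ≥ 0: for a = 0 the bound reads q ≤ 0, contradicting q ≥ 1, though the hypotheses can hold (e.g. n = 1 with G trivial). *)

theory Defs
  imports "HOL-Algebra.Left_Coset" "HOL-Algebra.Product_Groups" "HOL-Algebra.Bij"
    "HOL-Algebra.Sylow"
begin

section \<open>Orthogonal arrays\<close>

text \<open>The symbol sets \<open>X i\<close> may share one type without loss of generality, since they all
  have the same finite cardinality. The index set is \<open>{1..k}\<close>; values of \<open>X\<close> and \<open>\<pi>\<close> at other
  indices are irrelevant.\<close>

definition orthogonal_array ::
  "nat \<Rightarrow> nat \<Rightarrow> 's set \<Rightarrow> (nat \<Rightarrow> 'x set) \<Rightarrow> (nat \<Rightarrow> 's \<Rightarrow> 'x) \<Rightarrow> bool" where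
  "orthogonal_array k n S X \<pi> \<longleftrightarrow>
     (\<forall>i\<in>{1..k}. finite (X i) \<and> card (X i) = n \<and> \<pi> i \<in> S \<rightarrow> X i) \<and>
     (\<forall>i\<in>{1..k}. \<forall>j\<in>{1..k}. i \<noteq> j \<longrightarrow> bij_betw (\<lambda>s. (\<pi> i s, \<pi> j s)) S (X i \<times> X j))"

definition isotopic ::
  "nat \<Rightarrow> 's set \<Rightarrow> (nat \<Rightarrow> 'x set) \<Rightarrow> (nat \<Rightarrow> 's \<Rightarrow> 'x) \<Rightarrow>
   't set \<Rightarrow> (nat \<Rightarrow> 'y set) \<Rightarrow> (nat \<Rightarrow> 't \<Rightarrow> 'y) \<Rightarrow> bool" where
  "isotopic k S X \<pi> S' X' \<pi>' \<longleftrightarrow>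
     (\<exists>\<sigma> \<tau>. bij_betw \<sigma> S S' \<and>
        (\<forall>i\<in>{1..k}. bij_betw (\<tau> i) (X i) (X' i) \<and> (\<forall>s\<in>S. \<pi>' i (\<sigma> s) = \<tau> i (\<pi> i s))))"

text \<open>The image of \<open>S\<close> in \<open>\<Pi>\<^sub>E i\<in>{1..k}. X i\<close>.\<close>

definition oa_rows :: "nat \<Rightarrow> 's set \<Rightarrow> (nat \<Rightarrow> 's \<Rightarrow> 'x) \<Rightarrow> (nat \<Rightarrow> 'x) set" where
  "oa_rows k S \<pi> = (\<lambda>s. \<lambda>i\<in>{1..k}. \<pi> i s) ` S"

definition row_act :: "nat \<Rightarrow> (nat \<Rightarrow> 'x \<Rightarrow> 'x) \<Rightarrow> (nat \<Rightarrow> 'x) \<Rightarrow> nat \<Rightarrow> 'x" where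
  "row_act k \<sigma> x = (\<lambda>i\<in>{1..k}. \<sigma> i (x i))"

definition autotopy_group ::
  "nat \<Rightarrow> 's set \<Rightarrow> (nat \<Rightarrow> 'x set) \<Rightarrow> (nat \<Rightarrow> 's \<Rightarrow> 'x) \<Rightarrow> (nat \<Rightarrow> 'x \<Rightarrow> 'x) monoid" where
  "autotopy_group k S X \<pi> =
     (product_group {1..k} (\<lambda>i. BijGroup (X i)))
       \<lparr>carrier := {\<sigma> \<in> carrier (product_group {1..k} (\<lambda>i. BijGroup (X i))).
                      row_act k \<sigma> ` oa_rows k S \<pi> = oa_rows k S \<pi>}\<rparr>"

definition transitive_oa ::
  "nat \<Rightarrow> 's set \<Rightarrow> (nat \<Rightarrow> 'x set) \<Rightarrow> (nat \<Rightarrow> 's \<Rightarrow> 'x) \<Rightarrow> bool" where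
  "transitive_oa k S X \<pi> \<longleftrightarrow>
     (\<forall>x\<in>oa_rows k S \<pi>. \<forall>y\<in>oa_rows k S \<pi>.
        \<exists>\<sigma>\<in>carrier (autotopy_group k S X \<pi>). row_act k \<sigma> x = y)"


section \<open>Group packets\<close>

text \<open>\<open>K\<close> is the common pairwise intersection; it is determined by \<open>H\<close> as soon as \<open>k \<ge> 2\<close>.
  The explicit finiteness is needed only for \<open>n = 0\<close>, infinite sets having \<open>card\<close> zero.\<close>

definition group_packet ::
  "nat \<Rightarrow> nat \<Rightarrow> ('g, 'b) monoid_scheme \<Rightarrow> (nat \<Rightarrow> 'g set) \<Rightarrow> 'g set \<Rightarrow> bool" where
  "group_packet k n G H K \<longleftrightarrow>
     group G \<and> subgroup K G \<and>
     (\<forall>i\<in>{1..k}. subgroup (H i) G) \<and>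
     (\<forall>i\<in>{1..k}. \<forall>j\<in>{1..k}. i \<noteq> j \<longrightarrow> H i \<inter> H j = K) \<and>
     (\<forall>i\<in>{1..k}.
        finite (lcosets\<^bsub>G\<^esub> (H i)) \<and> card (lcosets\<^bsub>G\<^esub> (H i)) = n \<and>
        finite (lcosets\<^bsub>G\<lparr>carrier := H i\<rparr>\<^esub> K) \<and> card (lcosets\<^bsub>G\<lparr>carrier := H i\<rparr>\<^esub> K) = n)"

text \<open>The map \<open>G/K \<rightarrow> G/H\<^sub>i\<close>, \<open>gK \<mapsto> gH\<^sub>i\<close> for \<open>K \<subseteq> H\<^sub>i\<close>, written as a product of subsets:
  \<open>gK\<cdot>H\<^sub>i = gH\<^sub>i\<close>.\<close>

definition packet_proj ::
  "('g, 'b) monoid_scheme \<Rightarrow> (nat \<Rightarrow> 'g set) \<Rightarrow> nat \<Rightarrow> 'g set \<Rightarrow> 'g set" where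
  "packet_proj G H i C = C <#>\<^bsub>G\<^esub> H i"

lemma packet_proj_coset:
  assumes "group G" "subgroup K G" "subgroup (H i) G" "K \<subseteq> H i" "g \<in> carrier G"
  shows "packet_proj G H i (g <#\<^bsub>G\<^esub> K) = g <#\<^bsub>G\<^esub> H i"
proof -
  interpret group G by fact
  have sub: "K \<subseteq> carrier G" "H i \<subseteq> carrier G"
    using assms(2,3) subgroup.subset by blast+
  have "K <#>\<^bsub>G\<^esub> H i = H i"
  proof
    show "K <#>\<^bsub>G\<^esub> H i \<subseteq> H i"
      using assms(3,4) by (auto simp: set_mult_def subgroup.m_closed subset_iff)
    show "H i \<subseteq> K <#>\<^bsub>G\<^esub> H i"
    proof
      fix h assume "h \<in> H i"
      moreover have "h = \<one>\<^bsub>G\<^esub> \<otimes>\<^bsub>G\<^esub> h" using \<open>h \<in> H i\<close> sub by auto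
      moreover have "\<one>\<^bsub>G\<^esub> \<in> K" using assms(2) by (rule subgroup.one_closed)
      ultimately show "h \<in> K <#>\<^bsub>G\<^esub> H i" unfolding set_mult_def by blast
    qed
  qed
  then show ?thesis
    using setmult_lcos_assoc[OF sub assms(5)] by (simp add: packet_proj_def)
qed

definition sylow_subgroup :: "nat \<Rightarrow> 'g set \<Rightarrow> ('g, 'b) monoid_scheme \<Rightarrow> bool" where
  "sylow_subgroup p P G \<longleftrightarrow> subgroup P G \<and> card P = p ^ multiplicity p (order G)"

text \<open>With exponent \<open>a = 0\<close>, a bound \<open>q \<le> p ^ a - 1\<close> would contradict \<open>q \<ge> 1\<close>, although all
  other hypotheses can hold whenever \<open>p\<close> does not divide \<open>n\<close>: the Sylow \<open>p\<close>-subgroup is then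
  allowed to be trivial. The simplest instance is \<open>n = 1\<close>; for \<open>n = 3\<close>, \<open>p = 2\<close>, \<open>q = 1\<close> one can
  take three subgroups of order 3 in \<open>\<int>/3 \<times> \<int>/3\<close>.\<close>

lemma exponent_zero_instance:
  fixes q p :: nat
  defines "G \<equiv> singleton_group ()"
  defines "S \<equiv> lcosets\<^bsub>G\<^esub> {()}" and "X \<equiv> (\<lambda>i::nat. lcosets\<^bsub>G\<^esub> {()})"
    and "\<pi> \<equiv> packet_proj G (\<lambda>i. {()})"
  shows "orthogonal_array (q + 2) 1 S X \<pi>" "transitive_oa (q + 2) S X \<pi>"
    "group_packet (q + 2) 1 G (\<lambda>i. {()}) {()}" "finite (carrier G)"
    "isotopic (q + 2) S X \<pi> S X \<pi>"
    "sylow_subgroup p {()} G" "{()} \<lhd> G"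
proof -
  have grp: "group G" by (simp add: G_def)
  interpret group G by (rule grp)
  have car: "carrier G = {()}" by (simp add: G_def)
  have sub: "subgroup {()} G" using subgroup_self by (simp add: car)
  have upd: "G\<lparr>carrier := {()}\<rparr> = G" by (simp add: G_def singleton_group_def)
  have lc: "lcosets\<^bsub>G\<^esub> {()} = {{()}}"
    by (auto simp: LCOSETS_def l_coset_def car)
  have S: "S = {{()}}" and X: "X = (\<lambda>i. {{()}})" by (simp_all add: S_def X_def lc)
  have \<pi>: "\<pi> i {()} = {()}" for i
    by (auto simp: \<pi>_def packet_proj_def set_mult_def)
  show "orthogonal_array (q + 2) 1 S X \<pi>"
    by (auto simp: orthogonal_array_def S X \<pi> bij_betw_def)
  show "group_packet (q + 2) 1 G (\<lambda>i. {()}) {()}"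
    by (simp add: group_packet_def grp sub lc upd)
  show "isotopic (q + 2) S X \<pi> S X \<pi>"
    unfolding isotopic_def by (rule exI[of _ id], rule exI[of _ "\<lambda>_. id"]) simp
  show "finite (carrier G)" by (simp add: car)
  show "sylow_subgroup p {()} G"
    by (simp add: sylow_subgroup_def sub order_def car)
  show "{()} \<lhd> G"
    using normal_inv_iff sub by (auto simp: car)
  let ?e = "\<lambda>i\<in>{1..q + 2}. \<lambda>x\<in>{{()}}. x"
  have rows: "oa_rows (q + 2) S \<pi> = {\<lambda>i\<in>{1..q + 2}. {()}}"
    by (auto simp: oa_rows_def S \<pi>)
  have act: "row_act (q + 2) ?e (\<lambda>i\<in>{1..q + 2}. {()}) = (\<lambda>i\<in>{1..q + 2}. {()})"
    by (auto simp: row_act_def fun_eq_iff)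
  have "?e \<in> carrier (autotopy_group (q + 2) S X \<pi>)"
    unfolding autotopy_group_def rows using id_Bij[of "{{()}}"] act
    by (simp add: X BijGroup_def)
  then show "transitive_oa (q + 2) S X \<pi>"
    unfolding transitive_oa_def rows using act by blast
qed

end

theory Submission
  imports Defs "HOL-Algebra.SndIsomorphismGrp"
begin

text \<open>Since \<open>P\<close> is normal, its intersection with any subgroup of \<open>G\<close> is a Sylow subgroup of that
  subgroup. If \<open>|P \<inter> K| = p ^ t\<close>, then \<open>|P \<inter> H\<^sub>i| = p ^ (t + a)\<close> and \<open>|P| = p ^ (t + 2a)\<close>. The
  \<open>q + 2\<close> sets \<open>(P \<inter> H\<^sub>i) - K\<close> are disjoint subsets of \<open>P - K\<close>, so counting elements and
  dividing by \<open>p ^ t (p ^ a - 1)\<close> gives \<open>q + 2 \<le> p ^ a + 1\<close>.\<close>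

text \<open>The second isomorphism theorem gives \<open>[H : P \<inter> H] = [PH : P]\<close>, which
  divides \<open>[G : P]\<close> and so is prime to \<open>p\<close>. As \<open>P \<inter> H\<close>
  is also a \<open>p\<close>-group, its order is the exact power of \<open>p\<close> in
  \<open>card H\<close>.\<close>

lemma (in group) card_Int_normal_Sylow:
  assumes fin: "finite (carrier G)" and p: "prime p"
    and syl: "sylow_subgroup p P G" and normal: "P \<lhd> G" and H: "subgroup H G"
  shows "card (P \<inter> H) = p ^ multiplicity p (card H)"
proof -
  interpret second_isomorphism_grp P G H
    using normal H by (simp add: second_isomorphism_grp_def second_isomorphism_grp_axioms_def)
  have P: "subgroup P G" and card_P: "card P = p ^ multiplicity p (order G)"
    using syl by (auto simp: sylow_subgroup_def)
  have PH: "subgroup (P <#> H) G" by (rule normal_set_mult_subgroup)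
  let ?H = "G\<lparr>carrier := H\<rparr>" and ?PH = "G\<lparr>carrier := P <#> H\<rparr>"
  have Int_H: "subgroup (P \<inter> H) ?H" and P_PH: "subgroup P ?PH"
    and Int_P: "subgroup (P \<inter> H) (G\<lparr>carrier := P\<rparr>)"
    using P H PH subgroups_Inter_pair[OF P H] H_contained_in_set_mult
    by (simp_all add: subgroup_incl)
  define r where "r = card (rcosets\<^bsub>?H\<^esub> (P \<inter> H))"
  \<comment> \<open>The bijection underlying the isomorphism of \<open>H / (P \<inter> H)\<close>
    with \<open>PH / P\<close>; it makes \<open>r\<close> the index of \<open>P\<close> in
    \<open>P <#> H\<close> as well.\<close>
  have "bij_betw (\<lambda>X. the_elem ((\<lambda>g. P #> g) ` X))
          (rcosets\<^bsub>?H\<^esub> (P \<inter> H)) (rcosets\<^bsub>?PH\<^esub> P)"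
    using normal_intersection_quotient_isom by (simp add: iso_def FactGroup_def)
  then have r: "card (rcosets\<^bsub>?PH\<^esub> P) = r"
    unfolding r_def by (simp add: bij_betw_same_card)
  have card_H: "r * card (P \<inter> H) = card H"
    using group.lagrange[OF subgroup_imp_group[OF H] Int_H] by (simp add: r_def order_def)
  have card_PH: "r * card P = card (P <#> H)"
    using group.lagrange[OF subgroup_imp_group[OF PH] P_PH] r by (simp add: order_def)
  have "card (P \<inter> H) dvd card P"
    using group.lagrange[OF subgroup_imp_group[OF P] Int_P, symmetric] by (simp add: order_def)
  then obtain i where i: "card (P \<inter> H) = p ^ i"
    using p by (auto simp: card_P divides_primepow_nat)
  have "r * card P dvd order G"
    using lagrange[OF PH, symmetric] by (simp add: card_PH)
  \<comment> \<open>Finiteness makes \<open>order G\<close> nonzero, so \<open>card P\<close> is the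
    largest power of \<open>p\<close> dividing it.\<close>
  moreover have "\<not> p * card P dvd order G"
    using prime_gt_1_nat[OF p] fin order_gt_0_iff_finite
      power_dvd_iff_le_multiplicity[of "order G" p "Suc (multiplicity p (order G))"]
    by (auto simp: card_P)
  \<comment> \<open>Otherwise \<open>p * card P\<close> would divide \<open>r * card P\<close>,
    hence \<open>order G\<close>.\<close>
  ultimately have "\<not> p dvd r"
    by (meson dvd_refl dvd_trans mult_dvd_mono)
  then have "multiplicity p (card H) = i"
    using p card_H[symmetric]
    by (intro multiplicity_decomposeI[of _ _ _ r]) (auto simp: i mult.commute)
  then show ?thesis using i by simp
qed

text \<open>The sets \<open>A i\<close> form a sunflower with core \<open>K\<close>: the petals
  \<open>A i - K\<close> are pairwise disjoint inside \<open>P - K\<close>. The truncated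
  subtractions are exact because \<open>K\<close> lies in \<open>P\<close> and in every
  \<open>A i\<close>.\<close>

lemma card_disjoint_differences:
  assumes "finite P" and "finite I" and "\<And>i. i \<in> I \<Longrightarrow> A i \<subseteq> P" and "K \<subseteq> P"
    and "\<And>i j. i \<in> I \<Longrightarrow> j \<in> I \<Longrightarrow> i \<noteq> j \<Longrightarrow> A i \<inter> A j = K"
    and "\<And>i. i \<in> I \<Longrightarrow> K \<subseteq> A i"
  shows "(\<Sum>i\<in>I. card (A i) - card K) \<le> card P - card K"
proof -
  have K: "finite K" using assms(1,4) by (rule rev_finite_subset)
  have "(\<Sum>i\<in>I. card (A i) - card K) = (\<Sum>i\<in>I. card (A i - K))"
    using assms(6) K by (simp add: card_Diff_subset)
  also have "\<dots> = card (\<Union>i\<in>I. A i - K)"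
  proof (rule card_UN_disjoint[symmetric])
    show "\<forall>i\<in>I. finite (A i - K)"
      using assms(1,3) by (auto intro: finite_subset)
    show "\<forall>i\<in>I. \<forall>j\<in>I. i \<noteq> j \<longrightarrow> (A i - K) \<inter> (A j - K) = {}"
      using assms(5) by blast
  qed (rule assms(2))
  also have "\<dots> \<le> card (P - K)"
    using assms(1,3) by (intro card_mono) auto
  also have "\<dots> = card P - card K"
    using assms(4) K by (simp add: card_Diff_subset)
  finally show ?thesis .
qed

theorem theorem4p7:
  fixes q n p a :: nat
    and S :: "'s set" and X :: "nat \<Rightarrow> 'x set" and \<pi> :: "nat \<Rightarrow> 's \<Rightarrow> 'x"
    and G :: "('g, 'b) monoid_scheme" and H :: "nat \<Rightarrow> 'g set" and K P :: "'g set"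
  assumes "q \<ge> 1" and "n \<ge> 1"
    and "orthogonal_array (q + 2) n S X \<pi>"
    and "transitive_oa (q + 2) S X \<pi>"
    and "group_packet (q + 2) n G H K"
    and "finite (carrier G)"
    and "isotopic (q + 2) (lcosets\<^bsub>G\<^esub> K) (\<lambda>i. lcosets\<^bsub>G\<^esub> (H i)) (packet_proj G H) S X \<pi>"
    and "prime p"
    and "p ^ a dvd n" and "\<not> p ^ (a + 1) dvd n"
    and "a \<ge> 1"
    and "sylow_subgroup p P G" and "P \<lhd> G"
  shows "q \<le> p ^ a - 1"
proof -
  note packet = assms(5)[unfolded group_packet_def]
  interpret group G using packet by blast
  have K: "subgroup K G" using packet by blast
  have H: "subgroup (H i) G" if "i \<in> {1..q+2}" for i using packet that by blast
  have Int: "H i \<inter> H j = K" if "i \<in> {1..q+2}" "j \<in> {1..q+2}" "i \<noteq> j" for i j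
    using packet that by blast
  \<comment> \<open>An index other than \<open>i\<close> is needed to exhibit \<open>K\<close> as an
    intersection with \<open>H i\<close>: 1 serves, or 2 when \<open>i = 1\<close>.\<close>
  have KH: "K \<subseteq> H i" if "i \<in> {1..q+2}" for i
    using Int[of i 1] Int[of i 2] that by (cases "i = 1") auto
  have card_H: "card (H i) = n * card K" if i: "i \<in> {1..q+2}" for i
  proof -
    have "finite (H i)"
      using finite_subset[OF subgroup.subset[OF H[OF i]]] assms(6) by blast
    moreover have "subgroup K (G\<lparr>carrier := H i\<rparr>)"
      using subgroup_incl K H KH i by blast
    ultimately show ?thesis
      using group.l_lagrange[OF subgroup_imp_group[OF H[OF i]], of K] packet i
      by (simp add: order_def)
  qed
  have "order G = n * (n * card K)"
    using l_lagrange[OF assms(6) H[of 1]] card_H[of 1] packet by simp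
  \<comment> \<open>Multiplicities add over a product only when its factors are nonzero.\<close>
  have pos: "card K > 0"
    using subgroup.finite_imp_card_positive[OF K assms(6)] .
  define t where "t = multiplicity p (card K)"
  have mult_n: "multiplicity p n = a"
    using assms(9,10) by (intro multiplicity_eqI) auto
  have mult_H: "multiplicity p (n * card K) = t + a"
    using assms(2,8) pos mult_n
    by (simp add: t_def prime_elem_multiplicity_mult_distrib)
  have mult_G: "multiplicity p (order G) = t + 2 * a"
    using assms(2,8) pos mult_n mult_H \<open>order G = n * (n * card K)\<close>
      prime_elem_multiplicity_mult_distrib[of p n "n * card K"] by simp
  note sylow_Int = card_Int_normal_Sylow[OF assms(6,8,12,13)]
  have cards: "card P = p ^ (t + 2 * a)" "card (P \<inter> K) = p ^ t"
    "\<And>i. i \<in> {1..q+2} \<Longrightarrow> card (P \<inter> H i) = p ^ (t + a)"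
    using assms(12) mult_G sylow_Int[OF K] sylow_Int[OF H] card_H mult_H
    by (auto simp: sylow_subgroup_def t_def)
  have "finite P"
    using finite_subset[OF normal_imp_subgroup[OF assms(13), THEN subgroup.subset] assms(6)] .
  \<comment> \<open>The sunflower here consists of the sets \<open>P \<inter> H i\<close>, with core
    \<open>P \<inter> K\<close>.\<close>
  then have "(\<Sum>i\<in>{1..q+2}. card (P \<inter> H i) - card (P \<inter> K)) \<le> card P - card (P \<inter> K)"
    using Int KH by (intro card_disjoint_differences) blast+
  then have "(q + 2) * (p ^ (t + a) - p ^ t) \<le> p ^ (t + 2 * a) - p ^ t"
    by (simp add: cards)
  \<comment> \<open>Factor \<open>p ^ t\<close> out of both sides and use
    \<open>x\<cdot>x - 1 = (x + 1)(x - 1)\<close> with \<open>x = p ^ a\<close>.\<close>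
  then have "p ^ t * ((q + 2) * (p ^ a - 1)) \<le> p ^ t * ((p ^ a + 1) * (p ^ a - 1))"
    by (simp add: power_add mult_2_right algebra_simps)
  \<comment> \<open>Here \<open>a \<ge> 1\<close> enters: it makes the common factor
    \<open>p ^ a - 1\<close> positive, so that it can be cancelled.\<close>
  moreover have "p ^ a > 1" "p ^ t > 0"
    using prime_gt_1_nat[OF assms(8)] assms(11) one_less_power[of p a] by auto
  ultimately have "q + 2 \<le> p ^ a + 1"
    by (simp only: mult_le_cancel1 mult_le_cancel2)
  then show ?thesis by simp
qed

end
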